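(* Let $m\ge 1$ and let $n_1,\dots,n_m$ be positive integers (not necessarily distinct). Let $$M=\bigoplus_{i=1}^m I_{n_i}\otimes M_{n_i}(\mathbb{C})\subseteq M_d(\mathbb{C}),\qquad d=\sum_{i=1}^m n_i^2 .$$ Then there exists a basis of $M$ (as a complex vector space) consisting entirely of unitary matrices which are pairwise orthogonal under the normalized trace inner product.
   Context: $M_n(\mathbb{C})$ denotes the algebra of complex $n\times n$ matrices and $I_n$ the $n\times n$ identity matrix. $\bigoplus_{i=1}^m I_{n_i}\otimes M_{n_i}(\mathbb{C})$ denotes the unital $*$-subalgebra of $M_d(\mathbb{C})$ consisting of all block-diagonal matrices $\bigoplus_{i=1}^m (I_{n_i}\otimes x_i)$ with $x_i\in M_{n_i}(\mathbb{C})$, where $\otimes$ is the Kronecker product. The normalized trace on $M_d(\mathbb{C})$ is $\tau(A)=\frac1d\operatorname{tr}(A)$, and the normalized trace inner product on $M$ is $\langle A,B\rangle=\tau(AB^* )$. *)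

theory Defs
  imports "Jordan_Normal_Form.VS_Connect" "Jordan_Normal_Form.Schur_Decomposition"
begin

text \<open>The Kronecker product: the block in position \<open>(k, l)\<close> is \<open>A $$ (k, l) \<cdot>\<^sub>m B\<close>.\<close>

definition kronecker_mat :: "'a :: times mat \<Rightarrow> 'a mat \<Rightarrow> 'a mat" where
  "kronecker_mat A B = mat (dim_row A * dim_row B) (dim_col A * dim_col B)
     (\<lambda>(i, j). A $$ (i div dim_row B, j div dim_col B) * B $$ (i mod dim_row B, j mod dim_col B))"

text \<open>The algebra \<open>\<Oplus>\<^sub>i I \<otimes> M\<close>, with block sizes \<open>n 0, \<dots>, n (m - 1)\<close>: the indices
  \<open>1, \<dots>, m\<close> are shifted by one. Values \<open>n i\<close> and \<open>x i\<close> for \<open>i \<ge> m\<close> are irrelevant.\<close>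

definition block_algebra :: "nat \<Rightarrow> (nat \<Rightarrow> nat) \<Rightarrow> complex mat set" where
  "block_algebra m n =
     {diag_block_mat (map (\<lambda>i. kronecker_mat (1\<^sub>m (n i)) (x i)) [0..<m]) | x.
        \<forall>i<m. x i \<in> carrier_mat (n i) (n i)}"

definition unitary_mat :: "nat \<Rightarrow> complex mat \<Rightarrow> bool" where
  "unitary_mat d U \<longleftrightarrow> U \<in> carrier_mat d d \<and>
     U * mat_adjoint U = 1\<^sub>m d \<and> mat_adjoint U * U = 1\<^sub>m d"

text \<open>The parameter \<open>d\<close> is the size of the matrix; the two definitions are meant for
  \<open>A, B \<in> carrier_mat d d\<close>.\<close>

definition normalized_trace :: "nat \<Rightarrow> complex mat \<Rightarrow> complex" where
  "normalized_trace d A = 1 / of_nat d * (\<Sum>i<d. A $$ (i, i))"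

definition trace_inner :: "nat \<Rightarrow> complex mat \<Rightarrow> complex mat \<Rightarrow> complex" where
  "trace_inner d A B = normalized_trace d (A * mat_adjoint B)"

lemma block_algebra_0: "block_algebra 0 n = {0\<^sub>m 0 0}"
  by (auto simp: block_algebra_def)

lemma kronecker_carrier [simp]:
  "A \<in> carrier_mat r c \<Longrightarrow> B \<in> carrier_mat r' c' \<Longrightarrow>
   kronecker_mat A B \<in> carrier_mat (r * r') (c * c')"
  by (auto simp: kronecker_mat_def)

lemma block_algebra_Suc:
  "block_algebra (Suc m) n =
     {four_block_mat A (0\<^sub>m (\<Sum>i<m. (n i)\<^sup>2) ((n m)\<^sup>2)) (0\<^sub>m ((n m)\<^sup>2) (\<Sum>i<m. (n i)\<^sup>2))
        (kronecker_mat (1\<^sub>m (n m)) y) | A y. A \<in> block_algebra m n \<and> y \<in> carrier_mat (n m) (n m)}"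
  (is "_ = ?R")
  and block_algebra_carrier:
  "block_algebra m n \<subseteq> carrier_mat (\<Sum>i<m. (n i)\<^sup>2) (\<Sum>i<m. (n i)\<^sup>2)"
proof -
  let ?D = "\<lambda>m x. diag_block_mat (map (\<lambda>i. kronecker_mat (1\<^sub>m (n i)) (x i)) [0..<m])"
  have D: "?D m x \<in> carrier_mat (\<Sum>i<m. (n i)\<^sup>2) (\<Sum>i<m. (n i)\<^sup>2)"
    if "\<forall>i<m. x i \<in> carrier_mat (n i) (n i)" for m x
    using that
  proof (induction m)
    case (Suc m)
    then have "?D m x \<in> carrier_mat (\<Sum>i<m. (n i)\<^sup>2) (\<Sum>i<m. (n i)\<^sup>2)" by simp
    moreover have "kronecker_mat (1\<^sub>m (n m)) (x m) \<in> carrier_mat ((n m)\<^sup>2) ((n m)\<^sup>2)"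
      using Suc.prems by (simp add: power2_eq_square)
    ultimately show ?case by (simp add: diag_block_mat_last Let_def)
  qed simp
  then show "block_algebra m n \<subseteq> carrier_mat (\<Sum>i<m. (n i)\<^sup>2) (\<Sum>i<m. (n i)\<^sup>2)"
    unfolding block_algebra_def by blast
  have S: "?D (Suc m) x = four_block_mat (?D m x) (0\<^sub>m (\<Sum>i<m. (n i)\<^sup>2) ((n m)\<^sup>2))
      (0\<^sub>m ((n m)\<^sup>2) (\<Sum>i<m. (n i)\<^sup>2)) (kronecker_mat (1\<^sub>m (n m)) (x m))"
    if x: "\<forall>i<Suc m. x i \<in> carrier_mat (n i) (n i)" for x
  proof -
    have "kronecker_mat (1\<^sub>m (n m)) (x m) \<in> carrier_mat ((n m)\<^sup>2) ((n m)\<^sup>2)"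
      using x by (simp add: power2_eq_square)
    moreover have "?D m x \<in> carrier_mat (\<Sum>i<m. (n i)\<^sup>2) (\<Sum>i<m. (n i)\<^sup>2)"
      by (intro D) (use x in simp)
    ultimately show ?thesis by (simp add: diag_block_mat_last Let_def)
  qed
  show "block_algebra (Suc m) n = ?R"
  proof (intro equalityI subsetI)
    fix X assume "X \<in> block_algebra (Suc m) n"
    then obtain x where x: "\<forall>i<Suc m. x i \<in> carrier_mat (n i) (n i)" "X = ?D (Suc m) x"
      unfolding block_algebra_def by blast
    have "?D m x \<in> block_algebra m n" using x(1) unfolding block_algebra_def by auto
    moreover have "x m \<in> carrier_mat (n m) (n m)" using x(1) by simp
    ultimately show "X \<in> ?R" using S[OF x(1)] x(2) by (intro CollectI exI conjI) simp_all
  next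
    fix X assume "X \<in> ?R"
    then obtain x y where x: "\<forall>i<m. x i \<in> carrier_mat (n i) (n i)" and y: "y \<in> carrier_mat (n m) (n m)"
      and X: "X = four_block_mat (?D m x) (0\<^sub>m (\<Sum>i<m. (n i)\<^sup>2) ((n m)\<^sup>2))
        (0\<^sub>m ((n m)\<^sup>2) (\<Sum>i<m. (n i)\<^sup>2)) (kronecker_mat (1\<^sub>m (n m)) y)"
      unfolding block_algebra_def by blast
    let ?x = "x(m := y)"
    have c: "\<forall>i<Suc m. ?x i \<in> carrier_mat (n i) (n i)" using x y by (auto simp: less_Suc_eq)
    have "?D m ?x = ?D m x" by (intro arg_cong[of _ _ diag_block_mat]) auto
    then have "X = ?D (Suc m) ?x" using S[OF c] X by simp
    then show "X \<in> block_algebra (Suc m) n" using c unfolding block_algebra_def by blast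
  qed
qed

lemma kronecker_one_add:
  assumes "x \<in> carrier_mat k k" "y \<in> carrier_mat k k"
  shows "kronecker_mat (1\<^sub>m k) x + kronecker_mat (1\<^sub>m k) y =
         kronecker_mat (1\<^sub>m k :: complex mat) (x + y)"
proof (cases "k = 0")
  case True
  then show ?thesis using assms by (intro eq_matI) (auto simp: kronecker_mat_def)
next
  case False
  then show ?thesis using assms
    by (intro eq_matI) (auto simp: kronecker_mat_def less_mult_imp_div_less distrib_left)
qed

lemma kronecker_one_smult:
  assumes "x \<in> carrier_mat k k"
  shows "c \<cdot>\<^sub>m kronecker_mat (1\<^sub>m k) x = kronecker_mat (1\<^sub>m k :: complex mat) (c \<cdot>\<^sub>m x)"
proof (cases "k = 0")
  case True
  then show ?thesis using assms by (intro eq_matI) (auto simp: kronecker_mat_def)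
next
  case False
  then show ?thesis using assms
    by (intro eq_matI) (auto simp: kronecker_mat_def less_mult_imp_div_less)
qed

lemma block_algebra_add:
  "A \<in> block_algebra m n \<Longrightarrow> B \<in> block_algebra m n \<Longrightarrow> A + B \<in> block_algebra m n"
proof (induction m arbitrary: A B)
  case 0
  then show ?case by (auto simp: block_algebra_0)
next
  case (Suc m)
  let ?s = "\<Sum>i<m. (n i)\<^sup>2"
  obtain A' y B' z where
    A: "A = four_block_mat A' (0\<^sub>m ?s ((n m)\<^sup>2)) (0\<^sub>m ((n m)\<^sup>2) ?s) (kronecker_mat (1\<^sub>m (n m)) y)"
       "A' \<in> block_algebra m n" "y \<in> carrier_mat (n m) (n m)" and
    B: "B = four_block_mat B' (0\<^sub>m ?s ((n m)\<^sup>2)) (0\<^sub>m ((n m)\<^sup>2) ?s) (kronecker_mat (1\<^sub>m (n m)) z)"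
       "B' \<in> block_algebra m n" "z \<in> carrier_mat (n m) (n m)"
    using Suc.prems unfolding block_algebra_Suc by blast
  have c: "A' \<in> carrier_mat ?s ?s" "B' \<in> carrier_mat ?s ?s"
    using A(2) B(2) block_algebra_carrier by blast+
  have k: "kronecker_mat (1\<^sub>m (n m)) y \<in> carrier_mat ((n m)\<^sup>2) ((n m)\<^sup>2)"
    "kronecker_mat (1\<^sub>m (n m)) z \<in> carrier_mat ((n m)\<^sup>2) ((n m)\<^sup>2)"
    using A(3) B(3) by (simp_all add: power2_eq_square)
  have "A + B = four_block_mat (A' + B') (0\<^sub>m ?s ((n m)\<^sup>2)) (0\<^sub>m ((n m)\<^sup>2) ?s)
      (kronecker_mat (1\<^sub>m (n m)) (y + z))"
    unfolding A(1) B(1)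
    by (subst add_four_block_mat[OF c(1) _ _ k(1) c(2) _ _ k(2)])
       (auto simp: kronecker_one_add[OF A(3) B(3)])
  moreover have "A' + B' \<in> block_algebra m n" using Suc.IH A(2) B(2) by blast
  moreover have "y + z \<in> carrier_mat (n m) (n m)" using A(3) B(3) by simp
  ultimately show ?case unfolding block_algebra_Suc by (intro CollectI exI conjI)
qed

lemma block_algebra_smult:
  "A \<in> block_algebra m n \<Longrightarrow> c \<cdot>\<^sub>m A \<in> block_algebra m n"
proof (induction m arbitrary: A)
  case 0
  then show ?case by (auto simp: block_algebra_0)
next
  case (Suc m)
  let ?s = "\<Sum>i<m. (n i)\<^sup>2"
  obtain A' y where
    A: "A = four_block_mat A' (0\<^sub>m ?s ((n m)\<^sup>2)) (0\<^sub>m ((n m)\<^sup>2) ?s) (kronecker_mat (1\<^sub>m (n m)) y)"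
       "A' \<in> block_algebra m n" "y \<in> carrier_mat (n m) (n m)"
    using Suc.prems unfolding block_algebra_Suc by blast
  have a: "A' \<in> carrier_mat ?s ?s" using A(2) block_algebra_carrier by blast
  have k: "kronecker_mat (1\<^sub>m (n m)) y \<in> carrier_mat ((n m)\<^sup>2) ((n m)\<^sup>2)"
    using A(3) by (simp add: power2_eq_square)
  have "c \<cdot>\<^sub>m A = four_block_mat (c \<cdot>\<^sub>m A') (0\<^sub>m ?s ((n m)\<^sup>2)) (0\<^sub>m ((n m)\<^sup>2) ?s)
      (kronecker_mat (1\<^sub>m (n m)) (c \<cdot>\<^sub>m y))"
    unfolding A(1)
    by (subst smult_four_block_mat[OF a _ _ k]) (auto simp: kronecker_one_smult[OF A(3)])
  moreover have "c \<cdot>\<^sub>m A' \<in> block_algebra m n" using Suc.IH A(2) by blast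
  moreover have "c \<cdot>\<^sub>m y \<in> carrier_mat (n m) (n m)" using A(3) by simp
  ultimately show ?case unfolding block_algebra_Suc by (intro CollectI exI conjI)
qed

text \<open>Hence \<open>vectorspace.basis\<close> applied to the record with carrier \<open>block_algebra m n\<close>
  refers to a genuine complex vector space.\<close>

lemma block_algebra_vectorspace:
  assumes "d = (\<Sum>i<m. (n i)\<^sup>2)"
  shows "vectorspace class_ring (module_mat TYPE(complex) d d\<lparr>carrier := block_algebra m n\<rparr>)"
proof (rule vectorspace.subspace_is_vs[OF matrix_vs])
  have carr: "block_algebra m n \<subseteq> carrier_mat d d"
    unfolding assms by (rule block_algebra_carrier)
  define X where
    "X = diag_block_mat (map (\<lambda>i. kronecker_mat (1\<^sub>m (n i)) (0\<^sub>m (n i) (n i) :: complex mat)) [0..<m])"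
  have X: "X \<in> block_algebra m n"
    unfolding X_def block_algebra_def by (intro CollectI exI[of _ "\<lambda>i. 0\<^sub>m (n i) (n i)"]) auto
  then have "0 \<cdot>\<^sub>m X = 0\<^sub>m d d" using carr by (intro eq_matI) auto
  then have zero: "0\<^sub>m d d \<in> block_algebra m n" using block_algebra_smult[OF X, of 0] by simp
  have "submodule class_ring (block_algebra m n) (module_mat TYPE(complex) d d)"
    using carr zero matrix_vs[where ?'a = complex, of d d]
    by (intro submodule.intro)
       (auto simp: module_mat_simps vectorspace_def block_algebra_add block_algebra_smult)
  then show "VectorSpace.subspace class_ring (block_algebra m n) (module_mat TYPE(complex) d d)"
    by (intro VectorSpace.subspace.intro matrix_vs)
qed

end

theory Submission
  imports Defs
begin

text \<open>The normalized trace of \<open>M\<^sub>d\<close> gives an element \<open>\<Oplus>\<^sub>i I \<otimes> x\<^sub>i\<close> the value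
  \<open>1/d \<cdot> \<Sum>\<^sub>i n\<^sub>i tr x\<^sub>i\<close>, because the block \<open>x\<^sub>i\<close> is repeated \<open>n\<^sub>i\<close> times. As the algebra has
  dimension \<open>d = \<Sum>\<^sub>i n\<^sub>i\<^sup>2\<close>, the task is to find \<open>d\<close> orthonormal unitaries in it, and these can be
  written down explicitly. Let \<open>\<omega>\<close> and \<open>\<zeta>\<^sub>r\<close> be primitive roots of unity of orders \<open>d\<close> and
  \<open>r\<close>, and let \<open>s\<^sub>i = n\<^sub>0\<^sup>2 + \<dots> + n\<^sub>i\<^sub>-\<^sub>1\<^sup>2\<close>. For \<open>k < d\<close> the matrix \<open>U\<^sub>k\<close> is the element whose
  block \<open>i\<close>, of size \<open>r = n\<^sub>i\<close>, has the entries
  \<open>u(a, b) = r\<^sup>-\<^sup>1\<^sup>/\<^sup>2 \<cdot> \<zeta>\<^sub>r\<^sup>a\<^sup>b \<cdot> \<omega>\<^sup>k\<^sup>t\<close> with \<open>t = s\<^sub>i + r a + b\<close>.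

  This block is unitary since it is the unitary Fourier matrix of order \<open>r\<close>, multiplied by the
  diagonal unitaries with entries \<open>\<omega>\<^sup>k\<^sup>(\<^sup>s\<^sup>+\<^sup>r\<^sup>a\<^sup>)\<close> on the left and \<open>\<omega>\<^sup>k\<^sup>b\<close> on the right
  (\<open>phased_fourier_mat_unitary\<close>). In the inner product of \<open>U\<^sub>k\<close> and \<open>U\<^sub>l\<close> the multiplicity
  \<open>n\<^sub>i\<close> cancels the factor \<open>1/n\<^sub>i\<close> that comes from the two normalizations, so that every entry of
  every block contributes \<open>\<omega>\<^sup>(\<^sup>k\<^sup>-\<^sup>l\<^sup>)\<^sup>t\<close>. The exponents \<open>t\<close> run through \<open>0, \<dots>, d - 1\<close>, each
  once (\<open>sum_lessThan_offset\<close>), and the sum of the contributions is \<open>d\<close> for \<open>k = l\<close> and \<open>0\<close>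
  otherwise (\<open>fourier_orthogonal\<close>).

  For the same reason the \<open>U\<^sub>k\<close> span: up to nonzero factors that do not depend on \<open>k\<close>, the
  \<open>d\<close> block entries of \<open>\<Sum>\<^sub>k c\<^sub>k U\<^sub>k\<close> are the discrete Fourier transform of \<open>c\<close>, and this
  transform is onto (\<open>fourier_inversion\<close>).\<close>

section \<open>Sums over consecutive square blocks of indices\<close>

lemma sum_lessThan_mult:
  fixes f :: "nat \<Rightarrow> 'a::comm_monoid_add"
  shows "(\<Sum>t<r * q. f t) = (\<Sum>a<r. \<Sum>b<q. f (q * a + b))"
proof -
  have "(\<Sum>t<r * q. f t) = (\<Sum>a<r. sum f {a * q..<a * q + q})"
    by (rule sum.nat_group [symmetric])
  also have "\<dots> = (\<Sum>a<r. \<Sum>b<q. f (q * a + b))"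
  proof (rule sum.cong [OF refl])
    fix a
    show "sum f {a * q..<a * q + q} = (\<Sum>b<q. f (q * a + b))"
      using sum.shift_bounds_nat_ivl [of f 0 "a * q" q]
      by (simp add: lessThan_atLeast0 ac_simps)
  qed
  finally show ?thesis .
qed

lemma sum_lessThan_add:
  fixes f :: "nat \<Rightarrow> 'a::comm_monoid_add"
  shows "(\<Sum>t<s + k. f t) = (\<Sum>t<s. f t) + (\<Sum>t<k. f (s + t))"
  by (induction k) (simp_all add: ac_simps)

text \<open>The entries of all blocks are listed one after the other, block by block and row by row, so that
  entry \<open>(a, b)\<close> of block \<open>i\<close> gets the number \<open>offset n i + n i * a + b\<close>. By a coincidence of
  counts, \<open>offset n i\<close> is at the same time the row at which the \<open>n i\<close> copies of block \<open>i\<close> start in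
  the big matrix, and \<open>offset n m\<close> is both the dimension of the algebra and the size \<open>d\<close>.\<close>

definition offset :: "(nat \<Rightarrow> nat) \<Rightarrow> nat \<Rightarrow> nat" where
  "offset n i = (\<Sum>j<i. (n j)\<^sup>2)"

lemma offset_Suc: "offset n (Suc i) = offset n i + n i * n i"
  by (simp add: offset_def power2_eq_square)

lemma sum_lessThan_offset:
  fixes f :: "nat \<Rightarrow> 'a::comm_monoid_add"
  shows "(\<Sum>t<offset n m. f t) = (\<Sum>i<m. \<Sum>a<n i. \<Sum>b<n i. f (offset n i + n i * a + b))"
proof (induction m)
  case 0
  then show ?case by (simp add: offset_def)
next
  case (Suc m)
  then show ?case
    by (simp add: offset_Suc sum_lessThan_add sum_lessThan_mult ac_simps)
qed

lemma square_index_less: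
  fixes a b r :: nat
  assumes "a < r" "b < r"
  shows "r * a + b < r * r"
proof -
  have "r * a + b < r * Suc a" using assms(2) by simp
  also have "\<dots> \<le> r * r" using assms(1) by (intro mult_left_mono) auto
  finally show ?thesis .
qed

lemma block_index_less:
  assumes "i < m" "a < n i" "b < n i"
  shows "offset n i + n i * a + b < offset n m"
proof -
  have "offset n i + n i * a + b < offset n (Suc i)"
    using square_index_less [OF assms(2,3)] by (simp add: offset_Suc)
  also have "\<dots> \<le> offset n m"
    unfolding offset_def using assms(1) by (intro sum_mono2) auto
  finally show ?thesis .
qed

text \<open>The numbering of the block entries is injective, in the form in which it is used: prescribed
  block entries can be gathered in one vector.\<close>

lemma ex_vector_with_block_entries:
  "\<exists>y. \<forall>i<m. \<forall>a<n i. \<forall>b<n i. y (offset n i + n i * a + b) = g i a b"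
proof (induction m)
  case 0
  then show ?case by simp
next
  case (Suc m)
  then obtain y where y: "\<And>i a b. \<lbrakk>i < m; a < n i; b < n i\<rbrakk> \<Longrightarrow>
      y (offset n i + n i * a + b) = g i a b" by blast
  define z where "z t = (if t < offset n m then y t
    else g m ((t - offset n m) div n m) ((t - offset n m) mod n m))" for t
  have "z (offset n i + n i * a + b) = g i a b" if "i < Suc m" "a < n i" "b < n i" for i a b
  proof (cases "i < m")
    case True
    then show ?thesis using that y block_index_less [of i m a n b] by (simp add: z_def)
  next
    case False
    then have "i = m" using that by simp
    then show ?thesis using that by (simp add: z_def)
  qed
  then show ?case by blast
qed

section \<open>The discrete Fourier transform\<close>

text \<open>The entry \<open>\<omega>\<^sup>k\<^sup>t\<close> of the unnormalized Fourier matrix of order \<open>d\<close>. The exponent \<open>t\<close> is not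
  reduced modulo \<open>d\<close>, which makes the entry multiplicative in \<open>t\<close>.\<close>

definition fourier :: "nat \<Rightarrow> nat \<Rightarrow> nat \<Rightarrow> complex" where
  "fourier d k t = cis (2 * pi * real k / real d) ^ t"

lemma fourier_commute: "fourier d k t = fourier d t k"
  by (simp add: fourier_def DeMoivre mult_ac)

lemma fourier_add: "fourier d k (s + t) = fourier d k s * fourier d k t"
  by (simp add: fourier_def power_add)

lemma fourier_mult_cnj_self [simp]: "fourier d k t * cnj (fourier d k t) = 1"
  by (simp add: fourier_def DeMoivre cis_mult cis_cnj)

text \<open>A geometric sum: its ratio \<open>\<omega>\<^sup>k\<^sup>-\<^sup>l\<close> is a \<open>d\<close>-th root of unity, and it differs from \<open>1\<close>
  because the powers \<open>\<omega>\<^sup>0, \<dots>, \<omega>\<^sup>d\<^sup>-\<^sup>1\<close> are distinct.\<close>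

lemma fourier_orthogonal:
  assumes "k < d" "l < d"
  shows "(\<Sum>t<d. fourier d k t * cnj (fourier d l t)) = (if k = l then of_nat d else 0)"
proof (cases "k = l")
  case True
  then show ?thesis by simp
next
  case False
  let ?w = "\<lambda>k. cis (2 * pi * real k / real d)"
  let ?z = "?w k * cnj (?w l)"
  have inj: "inj_on ?w {..<d}"
    using bij_betw_roots_unity [of d] assms by (auto simp: bij_betw_def)
  have "?z \<noteq> 1"
  proof
    assume "?z = 1"
    then have "?w k * (cnj (?w l) * ?w l) = ?w l" by (simp flip: mult.assoc)
    moreover have "cnj (?w l) * ?w l = 1" by (simp add: cis_cnj cis_mult)
    ultimately have "?w k = ?w l" by (simp only: mult_1_right)
    then show False using inj_onD [OF inj] assms False by simp
  qed
  moreover have "?w j ^ d = 1" for j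
    using assms cis_multiple_2pi [of "real j"] by (simp add: DeMoivre)
  then have "?z ^ d = 1" by (simp add: power_mult_distrib flip: complex_cnj_power)
  moreover have "(\<Sum>t<d. fourier d k t * cnj (fourier d l t)) = (\<Sum>t<d. ?z ^ t)"
    by (simp add: fourier_def power_mult_distrib)
  ultimately show ?thesis using False by (simp add: geometric_sum)
qed

lemma fourier_inversion:
  "\<exists>c. \<forall>t<d. (\<Sum>k<d. c k * fourier d k t) = y t"
proof (intro exI allI impI)
  fix t assume t: "t < d"
  let ?c = "\<lambda>k. 1 / of_nat d * (\<Sum>s<d. y s * cnj (fourier d k s))"
  have "(\<Sum>k<d. ?c k * fourier d k t)
      = 1 / of_nat d * (\<Sum>k<d. \<Sum>s<d. y s * (fourier d k t * cnj (fourier d k s)))"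
    by (simp add: sum_distrib_left sum_distrib_right mult_ac)
  also have "\<dots> = 1 / of_nat d * (\<Sum>k<d. \<Sum>s<d. y s * (fourier d t k * cnj (fourier d s k)))"
    by (intro arg_cong2 [of _ _ _ _ "(*)"] sum.cong refl arg_cong [of _ _ cnj] fourier_commute)
  also have "\<dots> = 1 / of_nat d * (\<Sum>s<d. y s * (\<Sum>k<d. fourier d t k * cnj (fourier d s k)))"
    by (subst sum.swap) (simp add: sum_distrib_left)
  also have "\<dots> = 1 / of_nat d * (\<Sum>s<d. if t = s then y s * of_nat d else 0)"
    by (intro arg_cong2 [of _ _ _ _ "(*)"] refl sum.cong) (use t fourier_orthogonal in auto)
  also have "\<dots> = y t" using t by simp
  finally show "(\<Sum>k<d. ?c k * fourier d k t) = y t" .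
qed

section \<open>Adjoints, traces and bases of matrices\<close>

lemma mat_adjoint_carrier [simp]: "A \<in> carrier_mat r c \<Longrightarrow> mat_adjoint A \<in> carrier_mat c r"
  by (auto simp: mat_adjoint_def)

lemma mat_adjoint_dim [simp]:
  "dim_row (mat_adjoint A) = dim_col A" "dim_col (mat_adjoint A) = dim_row A"
  by (simp_all add: mat_adjoint_def)

lemma mat_adjoint_index [simp]:
  "A \<in> carrier_mat r c \<Longrightarrow> i < c \<Longrightarrow> j < r \<Longrightarrow> mat_adjoint A $$ (i, j) = cnj (A $$ (j, i))"
  by (auto simp: mat_adjoint_def mat_of_rows_index)

lemma mult_mat_adjoint_index:
  assumes "A \<in> carrier_mat r c" "B \<in> carrier_mat q c" "i < r" "j < q"
  shows "(A * mat_adjoint B) $$ (i, j) = (\<Sum>t<c. A $$ (i, t) * cnj (B $$ (j, t)))"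
  using assms by (simp add: scalar_prod_def lessThan_atLeast0)

lemma trace_inner_entries:
  assumes "A \<in> carrier_mat d d" "B \<in> carrier_mat d d"
  shows "trace_inner d A B = 1 / of_nat d * (\<Sum>p<d. \<Sum>q<d. A $$ (p, q) * cnj (B $$ (p, q)))"
  using assms
  by (simp add: trace_inner_def normalized_trace_def mult_mat_adjoint_index del: index_mult_mat)

text \<open>The link to the abstract notion of basis, with spanning expressed by matrix entries. Independence
  follows by pairing a vanishing combination with each \<open>W \<in> B\<close>: the result is the coefficient
  of \<open>W\<close>.\<close>

lemma basis_if_trace_orthonormal_spanning:
  fixes d :: nat and S B :: "complex mat set"
  defines "V \<equiv> module_mat TYPE(complex) d d\<lparr>carrier := S\<rparr>"
  assumes vs: "vectorspace class_ring V"
    and S: "S \<subseteq> carrier_mat d d"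
    and B: "finite B" "B \<subseteq> S"
    and orth: "\<And>U W. U \<in> B \<Longrightarrow> W \<in> B \<Longrightarrow> trace_inner d U W = (if U = W then 1 else 0)"
    and spanning: "\<And>A. A \<in> S \<Longrightarrow>
      \<exists>c. \<forall>p<d. \<forall>q<d. A $$ (p, q) = (\<Sum>U\<in>B. c U * U $$ (p, q))"
  shows "vectorspace.basis class_ring V B"
proof -
  interpret V: vectorspace class_ring V by (rule vs)
  have simps: "carrier V = S" "add V = (+)" "zero V = 0\<^sub>m d d" "module.smult V = (\<cdot>\<^sub>m)"
    by (simp_all add: V_def module_mat_simps)
  have lincomb_in: "V.lincomb a B \<in> S" for a
    using V.lincomb_closed [of B a] B(2) by (simp add: simps)
  have entry: "V.lincomb a B $$ (p, q) = (\<Sum>U\<in>B. a U * U $$ (p, q))"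
    if pq: "p < d" "q < d" for a p q
  proof -
    have "finsum V (\<lambda>U. a U \<cdot>\<^sub>m U) C \<in> S \<and>
        finsum V (\<lambda>U. a U \<cdot>\<^sub>m U) C $$ (p, q) = (\<Sum>U\<in>C. a U * U $$ (p, q))"
      if "finite C" "C \<subseteq> B" for C
      using that
    proof (induction C rule: finite_induct)
      case empty
      then show ?case
        using pq V.zero_closed by (simp add: simps)
    next
      case (insert U C)
      have smult: "a W \<cdot>\<^sub>m W \<in> S" if "W \<in> B" for W
        using V.smult_closed [of "a W" W] that B(2) by (auto simp: simps)
      have "finsum V (\<lambda>U. a U \<cdot>\<^sub>m U) (insert U C) = a U \<cdot>\<^sub>m U + finsum V (\<lambda>U. a U \<cdot>\<^sub>m U) C"
        using insert smult by (subst V.finsum_insert) (auto simp: simps)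
      moreover have "a U \<cdot>\<^sub>m U + finsum V (\<lambda>U. a U \<cdot>\<^sub>m U) C \<in> S"
        using V.add.m_closed [of "a U \<cdot>\<^sub>m U" "finsum V (\<lambda>U. a U \<cdot>\<^sub>m U) C"] insert smult
        by (simp add: simps)
      moreover have "U \<in> carrier_mat d d" "finsum V (\<lambda>U. a U \<cdot>\<^sub>m U) C \<in> carrier_mat d d"
        using insert S B(2) by auto
      ultimately show ?case using insert pq by auto
    qed
    then show ?thesis using B(1) by (simp add: V.lincomb_def simps)
  qed
  have "V.lin_indpt B"
  proof (rule V.finite_lin_indpt2)
    show "finite B" "B \<subseteq> carrier V" using B by (simp_all add: simps)
    fix a assume zero: "V.lincomb a B = \<zero>\<^bsub>V\<^esub>"
    show "\<forall>W\<in>B. a W = \<zero>\<^bsub>class_ring\<^esub>"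
    proof
      fix W assume W: "W \<in> B"
      have "0 = (\<Sum>p<d. \<Sum>q<d. V.lincomb a B $$ (p, q) * cnj (W $$ (p, q)))"
        by (simp add: zero simps)
      also have "\<dots> = (\<Sum>p<d. \<Sum>q<d. \<Sum>U\<in>B. a U * (U $$ (p, q) * cnj (W $$ (p, q))))"
        by (simp add: entry sum_distrib_right mult.assoc)
      also have "\<dots> = (\<Sum>p<d. \<Sum>U\<in>B. \<Sum>q<d. a U * (U $$ (p, q) * cnj (W $$ (p, q))))"
        by (intro sum.cong refl sum.swap)
      also have "\<dots> = (\<Sum>U\<in>B. \<Sum>p<d. \<Sum>q<d. a U * (U $$ (p, q) * cnj (W $$ (p, q))))"
        by (rule sum.swap)
      finally have "0 = 1 / of_nat d *
          (\<Sum>U\<in>B. \<Sum>p<d. \<Sum>q<d. a U * (U $$ (p, q) * cnj (W $$ (p, q))))" by simp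
      also have "\<dots> = (\<Sum>U\<in>B. a U * trace_inner d U W)"
        unfolding sum_distrib_left
      proof (rule sum.cong [OF refl])
        fix U assume "U \<in> B"
        then have "U \<in> carrier_mat d d" "W \<in> carrier_mat d d" using W B(2) S by auto
        then show "(\<Sum>p<d. \<Sum>q<d. 1 / of_nat d * (a U * (U $$ (p, q) * cnj (W $$ (p, q)))))
            = a U * trace_inner d U W"
          by (simp add: trace_inner_entries sum_distrib_left mult_ac)
      qed
      also have "\<dots> = (\<Sum>U\<in>B. if U = W then a U else 0)"
        using W by (intro sum.cong) (auto simp: orth)
      also have "\<dots> = a W" using W B(1) by simp
      finally show "a W = \<zero>\<^bsub>class_ring\<^esub>" by simp
    qed
  qed
  moreover have "V.span B = carrier V"
  proof (intro equalityI subsetI)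
    fix A assume A: "A \<in> carrier V"
    have "A \<in> S" using A by (simp add: simps)
    from spanning [OF this] obtain c
      where c: "\<forall>p<d. \<forall>q<d. A $$ (p, q) = (\<Sum>U\<in>B. c U * U $$ (p, q))" ..
    have "A = V.lincomb c B"
    proof (rule eq_matI)
      have carr: "A \<in> carrier_mat d d" "V.lincomb c B \<in> carrier_mat d d"
        using A S lincomb_in by (auto simp: simps)
      then show "dim_row A = dim_row (V.lincomb c B)" "dim_col A = dim_col (V.lincomb c B)"
        by auto
      show "A $$ (p, q) = V.lincomb c B $$ (p, q)"
        if "p < dim_row (V.lincomb c B)" "q < dim_col (V.lincomb c B)" for p q
        using c entry that carr by simp
    qed
    then show "A \<in> V.span B" unfolding V.span_def using B(1) by auto
  next
    fix A assume "A \<in> V.span B"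
    then show "A \<in> carrier V" using V.span_is_subset2 [of B] B(2) by (auto simp: simps)
  qed
  ultimately show ?thesis using B(2) by (simp add: V.basis_def simps)
qed

section \<open>Calculus in the block algebra\<close>

definition ampliated_sum :: "nat \<Rightarrow> (nat \<Rightarrow> nat) \<Rightarrow> (nat \<Rightarrow> complex mat) \<Rightarrow> complex mat" where
  "ampliated_sum m n x = diag_block_mat (map (\<lambda>i. kronecker_mat (1\<^sub>m (n i)) (x i)) [0..<m])"

lemma kronecker_one_index:
  fixes x :: "complex mat"
  assumes "x \<in> carrier_mat r r" "p < r * r" "q < r * r"
  shows "kronecker_mat (1\<^sub>m r) x $$ (p, q) =
    (if p div r = q div r then x $$ (p mod r, q mod r) else 0)"
  using assms by (auto simp: kronecker_mat_def less_mult_imp_div_less)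

text \<open>The map \<open>x \<mapsto> I \<otimes> x\<close> respects products and adjoints. The combination \<open>x y\<^sup>*\<close> serves
  both unitarity and the inner product.\<close>

lemma kronecker_one_mult_adjoint:
  fixes x y :: "complex mat"
  assumes x: "x \<in> carrier_mat r r" and y: "y \<in> carrier_mat r r"
  shows "kronecker_mat (1\<^sub>m r) x * mat_adjoint (kronecker_mat (1\<^sub>m r) y) =
    kronecker_mat (1\<^sub>m r) (x * mat_adjoint y)"
proof (rule eq_matI)
  have kx: "kronecker_mat (1\<^sub>m r) x \<in> carrier_mat (r * r) (r * r)"
    and ky: "kronecker_mat (1\<^sub>m r) y \<in> carrier_mat (r * r) (r * r)"
    and xy: "x * mat_adjoint y \<in> carrier_mat r r"
    and kxy: "kronecker_mat (1\<^sub>m r) (x * mat_adjoint y) \<in> carrier_mat (r * r) (r * r)"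
    using x y by simp_all
  have lhs: "kronecker_mat (1\<^sub>m r) x * mat_adjoint (kronecker_mat (1\<^sub>m r) y)
      \<in> carrier_mat (r * r) (r * r)"
    using kx ky by simp
  show "dim_row (kronecker_mat (1\<^sub>m r) x * mat_adjoint (kronecker_mat (1\<^sub>m r) y)) =
      dim_row (kronecker_mat (1\<^sub>m r) (x * mat_adjoint y))"
    "dim_col (kronecker_mat (1\<^sub>m r) x * mat_adjoint (kronecker_mat (1\<^sub>m r) y)) =
      dim_col (kronecker_mat (1\<^sub>m r) (x * mat_adjoint y))"
    using lhs kxy by auto
  fix p q assume "p < dim_row (kronecker_mat (1\<^sub>m r) (x * mat_adjoint y))"
    "q < dim_col (kronecker_mat (1\<^sub>m r) (x * mat_adjoint y))"
  then have pq: "p < r * r" "q < r * r" using kxy by auto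
  then have r: "r > 0" by (cases r) auto
  have "(kronecker_mat (1\<^sub>m r) x * mat_adjoint (kronecker_mat (1\<^sub>m r) y)) $$ (p, q)
      = (\<Sum>t<r * r. kronecker_mat (1\<^sub>m r) x $$ (p, t) * cnj (kronecker_mat (1\<^sub>m r) y $$ (q, t)))"
    by (rule mult_mat_adjoint_index [OF kx ky pq])
  also have "\<dots> = (\<Sum>c<r. \<Sum>b<r. if p div r = c \<and> q div r = c
      then x $$ (p mod r, b) * cnj (y $$ (q mod r, b)) else 0)"
    unfolding sum_lessThan_mult
    by (intro sum.cong refl)
      (use x y pq square_index_less in \<open>auto simp: kronecker_one_index\<close>)
  also have "\<dots> = (\<Sum>c<r. if p div r = c then if p div r = q div r
      then (\<Sum>b<r. x $$ (p mod r, b) * cnj (y $$ (q mod r, b))) else 0 else 0)"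
    by (intro sum.cong refl) auto
  also have "\<dots> = (if p div r = q div r
      then (\<Sum>b<r. x $$ (p mod r, b) * cnj (y $$ (q mod r, b))) else 0)"
    using pq by (simp add: less_mult_imp_div_less)
  also have "\<dots> = kronecker_mat (1\<^sub>m r) (x * mat_adjoint y) $$ (p, q)"
    using r by (simp add: kronecker_one_index [OF xy pq] mult_mat_adjoint_index [OF x y])
  finally show "(kronecker_mat (1\<^sub>m r) x * mat_adjoint (kronecker_mat (1\<^sub>m r) y)) $$ (p, q)
      = kronecker_mat (1\<^sub>m r) (x * mat_adjoint y) $$ (p, q)" .
qed

lemma kronecker_one_one: "kronecker_mat (1\<^sub>m r) (1\<^sub>m r :: complex mat) = 1\<^sub>m (r * r)"
proof (rule eq_matI)
  fix p q assume "p < dim_row (1\<^sub>m (r * r) :: complex mat)" "q < dim_col (1\<^sub>m (r * r) :: complex mat)"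
  then have pq: "p < r * r" "q < r * r" by auto
  then have "r > 0" by (cases r) auto
  moreover have "p = q" if "p div r = q div r" "p mod r = q mod r"
    using that by (metis div_mult_mod_eq)
  ultimately show "kronecker_mat (1\<^sub>m r) (1\<^sub>m r) $$ (p, q) = (1\<^sub>m (r * r) :: complex mat) $$ (p, q)"
    using pq by (auto simp: kronecker_one_index)
qed (simp_all add: kronecker_mat_def)

lemma ampliated_sum_carrier:
  assumes "\<And>i. i < m \<Longrightarrow> x i \<in> carrier_mat (n i) (n i)"
  shows "ampliated_sum m n x \<in> carrier_mat (offset n m) (offset n m)"
proof -
  have "ampliated_sum m n x \<in> block_algebra m n"
    using assms unfolding ampliated_sum_def block_algebra_def by blast
  then show ?thesis using block_algebra_carrier unfolding offset_def by blast
qed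

lemma ampliated_sum_0: "ampliated_sum 0 n x = 0\<^sub>m 0 0"
  by (simp add: ampliated_sum_def)

lemma ampliated_sum_Suc:
  assumes "\<And>i. i < Suc m \<Longrightarrow> x i \<in> carrier_mat (n i) (n i)"
  shows "ampliated_sum (Suc m) n x = four_block_mat (ampliated_sum m n x)
    (0\<^sub>m (offset n m) (n m * n m)) (0\<^sub>m (n m * n m) (offset n m)) (kronecker_mat (1\<^sub>m (n m)) (x m))"
proof -
  have "kronecker_mat (1\<^sub>m (n m)) (x m) \<in> carrier_mat (n m * n m) (n m * n m)"
    using assms by simp
  moreover have "ampliated_sum m n x \<in> carrier_mat (offset n m) (offset n m)"
    by (intro ampliated_sum_carrier) (use assms in simp)
  ultimately show ?thesis by (simp add: ampliated_sum_def diag_block_mat_last Let_def)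
qed

lemma mat_adjoint_block_diagonal:
  fixes A D :: "complex mat"
  assumes "A \<in> carrier_mat r r" "D \<in> carrier_mat q q"
  shows "mat_adjoint (four_block_mat A (0\<^sub>m r q) (0\<^sub>m q r) D) =
    four_block_mat (mat_adjoint A) (0\<^sub>m r q) (0\<^sub>m q r) (mat_adjoint D)"
proof (rule eq_matI)
  have F: "four_block_mat A (0\<^sub>m r q) (0\<^sub>m q r) D \<in> carrier_mat (r + q) (r + q)"
    using assms by simp
  have adj: "mat_adjoint A \<in> carrier_mat r r" "mat_adjoint D \<in> carrier_mat q q"
    using assms by simp_all
  show "dim_row (mat_adjoint (four_block_mat A (0\<^sub>m r q) (0\<^sub>m q r) D)) =
      dim_row (four_block_mat (mat_adjoint A) (0\<^sub>m r q) (0\<^sub>m q r) (mat_adjoint D))"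
    "dim_col (mat_adjoint (four_block_mat A (0\<^sub>m r q) (0\<^sub>m q r) D)) =
      dim_col (four_block_mat (mat_adjoint A) (0\<^sub>m r q) (0\<^sub>m q r) (mat_adjoint D))"
    using assms by auto
  fix i j
  assume "i < dim_row (four_block_mat (mat_adjoint A) (0\<^sub>m r q) (0\<^sub>m q r) (mat_adjoint D))"
    "j < dim_col (four_block_mat (mat_adjoint A) (0\<^sub>m r q) (0\<^sub>m q r) (mat_adjoint D))"
  then have "i < r + q" "j < r + q" using assms by auto
  then show "mat_adjoint (four_block_mat A (0\<^sub>m r q) (0\<^sub>m q r) D) $$ (i, j) =
      four_block_mat (mat_adjoint A) (0\<^sub>m r q) (0\<^sub>m q r) (mat_adjoint D) $$ (i, j)"
    using assms carrier_matD [OF adj(1)] carrier_matD [OF adj(2)] by (simp add: mat_adjoint_index [OF F])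
qed

lemma ampliated_sum_mult_adjoint:
  assumes "\<And>i. i < m \<Longrightarrow> x i \<in> carrier_mat (n i) (n i)"
    and "\<And>i. i < m \<Longrightarrow> y i \<in> carrier_mat (n i) (n i)"
  shows "ampliated_sum m n x * mat_adjoint (ampliated_sum m n y) =
    ampliated_sum m n (\<lambda>i. x i * mat_adjoint (y i))"
  using assms
proof (induction m)
  case 0
  show ?case by (intro eq_matI) (auto simp: ampliated_sum_0)
next
  case (Suc m)
  let ?s = "offset n m" and ?q = "n m * n m"
  have X: "ampliated_sum m n x \<in> carrier_mat ?s ?s" and Y: "ampliated_sum m n y \<in> carrier_mat ?s ?s"
    using Suc.prems by (simp_all add: ampliated_sum_carrier)
  have kx: "kronecker_mat (1\<^sub>m (n m)) (x m) \<in> carrier_mat ?q ?q"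
    and ky: "kronecker_mat (1\<^sub>m (n m)) (y m) \<in> carrier_mat ?q ?q"
    using Suc.prems by simp_all
  have xy: "x i * mat_adjoint (y i) \<in> carrier_mat (n i) (n i)" if "i < Suc m" for i
    using Suc.prems that by (meson mat_adjoint_carrier mult_carrier_mat)
  have XY: "ampliated_sum m n x * mat_adjoint (ampliated_sum m n y) \<in> carrier_mat ?s ?s"
    using X Y by simp
  have kxy: "kronecker_mat (1\<^sub>m (n m)) (x m) * mat_adjoint (kronecker_mat (1\<^sub>m (n m)) (y m))
      \<in> carrier_mat ?q ?q"
    using kx ky by simp
  have zero: "0\<^sub>m ?s ?q * mat_adjoint (kronecker_mat (1\<^sub>m (n m)) (y m)) = 0\<^sub>m ?s ?q"
    "0\<^sub>m ?q ?s * mat_adjoint (ampliated_sum m n y) = 0\<^sub>m ?q ?s"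
    by (rule left_mult_zero_mat [OF mat_adjoint_carrier [OF ky]],
        rule left_mult_zero_mat [OF mat_adjoint_carrier [OF Y]])
  have "ampliated_sum (Suc m) n x * mat_adjoint (ampliated_sum (Suc m) n y) =
      four_block_mat (ampliated_sum m n x) (0\<^sub>m ?s ?q) (0\<^sub>m ?q ?s) (kronecker_mat (1\<^sub>m (n m)) (x m)) *
      four_block_mat (mat_adjoint (ampliated_sum m n y)) (0\<^sub>m ?s ?q) (0\<^sub>m ?q ?s)
        (mat_adjoint (kronecker_mat (1\<^sub>m (n m)) (y m)))"
    using Suc.prems by (simp add: ampliated_sum_Suc mat_adjoint_block_diagonal [OF Y ky])
  also have "\<dots> = four_block_mat (ampliated_sum m n x * mat_adjoint (ampliated_sum m n y))
      (0\<^sub>m ?s ?q) (0\<^sub>m ?q ?s)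
      (kronecker_mat (1\<^sub>m (n m)) (x m) * mat_adjoint (kronecker_mat (1\<^sub>m (n m)) (y m)))"
    by (subst mult_four_block_mat [OF X _ _ kx mat_adjoint_carrier [OF Y] _ _ mat_adjoint_carrier [OF ky]])
      (use right_mult_zero_mat [OF X] right_mult_zero_mat [OF kx] XY kxy in \<open>simp_all add: zero\<close>)
  also have "\<dots> = ampliated_sum (Suc m) n (\<lambda>i. x i * mat_adjoint (y i))"
    using Suc.prems Suc.IH xy by (simp add: ampliated_sum_Suc kronecker_one_mult_adjoint)
  finally show ?case .
qed

lemma ampliated_sum_one: "ampliated_sum m n (\<lambda>i. 1\<^sub>m (n i)) = 1\<^sub>m (offset n m)"
proof (induction m)
  case 0
  show ?case by (auto simp: ampliated_sum_0 offset_def)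
next
  case (Suc m)
  then show ?case by (simp add: ampliated_sum_Suc kronecker_one_one offset_Suc)
qed

text \<open>This is where the multiplicities enter: block \<open>i\<close> is counted \<open>n i\<close> times in the trace.\<close>

lemma ampliated_sum_diagonal_sum:
  assumes "\<And>i. i < m \<Longrightarrow> x i \<in> carrier_mat (n i) (n i)"
  shows "(\<Sum>p<offset n m. ampliated_sum m n x $$ (p, p)) =
    (\<Sum>i<m. of_nat (n i) * (\<Sum>a<n i. x i $$ (a, a)))"
  using assms
proof (induction m)
  case 0
  then show ?case by (simp add: offset_def)
next
  case (Suc m)
  let ?s = "offset n m" and ?q = "n m * n m"
  have X: "ampliated_sum m n x \<in> carrier_mat ?s ?s"
    using Suc.prems by (simp add: ampliated_sum_carrier)
  have xm: "x m \<in> carrier_mat (n m) (n m)" using Suc.prems by simp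
  have k: "kronecker_mat (1\<^sub>m (n m)) (x m) \<in> carrier_mat ?q ?q"
    using xm by simp
  have "(\<Sum>p<?q. kronecker_mat (1\<^sub>m (n m)) (x m) $$ (p, p)) = (\<Sum>c<n m. \<Sum>a<n m. x m $$ (a, a))"
    unfolding sum_lessThan_mult
    by (intro sum.cong refl)
      (use square_index_less in \<open>auto simp: kronecker_one_index [OF xm]\<close>)
  moreover have "(\<Sum>p<offset n (Suc m). ampliated_sum (Suc m) n x $$ (p, p)) =
      (\<Sum>p<?s. ampliated_sum m n x $$ (p, p)) +
      (\<Sum>p<?q. kronecker_mat (1\<^sub>m (n m)) (x m) $$ (p, p))"
    using Suc.prems carrier_matD [OF X] carrier_matD [OF k]
    by (simp add: ampliated_sum_Suc offset_Suc sum_lessThan_add)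
  ultimately show ?case using Suc by simp
qed

text \<open>A position of the big matrix either reads off one fixed entry of one block or is identically zero.
  The choice does not depend on \<open>x\<close>, hence linear relations between the block entries of several
  elements carry over to the elements themselves.\<close>

lemma ampliated_sum_entry:
  assumes "p < offset n m" "q < offset n m"
  obtains
    (inside) i a b where "i < m" "a < n i" "b < n i"
      "\<And>x. (\<And>i. i < m \<Longrightarrow> x i \<in> carrier_mat (n i) (n i)) \<Longrightarrow>
        ampliated_sum m n x $$ (p, q) = x i $$ (a, b)"
  | (outside) "\<And>x. (\<And>i. i < m \<Longrightarrow> x i \<in> carrier_mat (n i) (n i)) \<Longrightarrow>
        ampliated_sum m n x $$ (p, q) = 0"
  using assms
proof (induction m arbitrary: thesis)
  case 0
  then show ?case by (simp add: offset_def)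
next
  case (Suc m)
  let ?s = "offset n m" and ?q = "n m * n m"
  have X: "ampliated_sum m n x \<in> carrier_mat ?s ?s"
    and k: "kronecker_mat (1\<^sub>m (n m)) (x m) \<in> carrier_mat ?q ?q"
    if "\<And>i. i < Suc m \<Longrightarrow> x i \<in> carrier_mat (n i) (n i)" for x
    using that by (simp_all add: ampliated_sum_carrier)
  have E: "ampliated_sum (Suc m) n x $$ (p, q) =
      (if p < ?s then if q < ?s then ampliated_sum m n x $$ (p, q) else 0
       else if q < ?s then 0 else kronecker_mat (1\<^sub>m (n m)) (x m) $$ (p - ?s, q - ?s))"
    if "\<And>i. i < Suc m \<Longrightarrow> x i \<in> carrier_mat (n i) (n i)" for x
    using X [OF that] k [OF that] Suc.prems(3,4)
    by (auto simp: ampliated_sum_Suc [OF that] offset_Suc)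
  consider "p < ?s" "q < ?s" | "\<not> p < ?s" "\<not> q < ?s" | "p < ?s \<longleftrightarrow> \<not> q < ?s" by blast
  then show ?case
  proof cases
    case 1
    show ?thesis
    proof (rule Suc.IH)
      show "p < ?s" "q < ?s" by (fact 1)+
    next
      fix i a b assume *: "i < m" "a < n i" "b < n i"
        "\<And>x. (\<And>i. i < m \<Longrightarrow> x i \<in> carrier_mat (n i) (n i)) \<Longrightarrow>
          ampliated_sum m n x $$ (p, q) = x i $$ (a, b)"
      show thesis by (rule Suc.prems(1) [of i a b]) (use * E 1 in auto)
    next
      assume "\<And>x. (\<And>i. i < m \<Longrightarrow> x i \<in> carrier_mat (n i) (n i)) \<Longrightarrow>
          ampliated_sum m n x $$ (p, q) = 0"
      then show thesis by (intro Suc.prems(2)) (use E 1 in auto)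
    qed
  next
    case 2
    define p' q' where "p' = p - ?s" and "q' = q - ?s"
    have pq: "p' < ?q" "q' < ?q"
      using 2 Suc.prems(3,4) by (auto simp: p'_def q'_def offset_Suc)
    then have r: "n m > 0" by (cases "n m") auto
    have E': "ampliated_sum (Suc m) n x $$ (p, q) =
        (if p' div n m = q' div n m then x m $$ (p' mod n m, q' mod n m) else 0)"
      if "\<And>i. i < Suc m \<Longrightarrow> x i \<in> carrier_mat (n i) (n i)" for x
      using E [OF that] 2 kronecker_one_index [OF _ pq, of "x m"] that
      by (simp add: p'_def q'_def)
    show ?thesis
    proof (cases "p' div n m = q' div n m")
      case True
      then show ?thesis
        by (intro Suc.prems(1) [of m "p' mod n m" "q' mod n m"]) (use E' r in auto)
    next
      case False
      then show ?thesis by (intro Suc.prems(2)) (use E' in auto)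
    qed
  next
    case 3
    then show ?thesis by (intro Suc.prems(2)) (use E in auto)
  qed
qed

section \<open>The unitary basis\<close>

text \<open>The block of size \<open>r\<close> of the basis unitary number \<open>k\<close>, where \<open>s\<close> is the number of its first
  entry. All its entries have modulus \<open>r\<^sup>-\<^sup>1\<^sup>/\<^sup>2\<close>.\<close>

definition phased_fourier_mat :: "nat \<Rightarrow> nat \<Rightarrow> nat \<Rightarrow> nat \<Rightarrow> complex mat" where
  "phased_fourier_mat d s r k = mat r r (\<lambda>(a, b).
     fourier r a b / of_real (sqrt (real r)) * fourier d k (s + r * a + b))"

lemma phased_fourier_mat_carrier [simp]: "phased_fourier_mat d s r k \<in> carrier_mat r r"
  by (simp add: phased_fourier_mat_def)

text \<open>As \<open>\<omega>\<^sup>k\<^sup>(\<^sup>s\<^sup>+\<^sup>r\<^sup>a\<^sup>+\<^sup>b\<^sup>)\<close> is a function of \<open>a\<close> times a function of \<open>b\<close>, the phases of the columns cancel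
  in the product of two rows, those of the rows come out of the sum, and the orthogonality of the
  Fourier matrix of order \<open>r\<close> remains.\<close>

lemma phased_fourier_mat_unitary:
  "phased_fourier_mat d s r k * mat_adjoint (phased_fourier_mat d s r k) = 1\<^sub>m r"
proof (rule eq_matI)
  let ?u = "phased_fourier_mat d s r k"
  show "dim_row (?u * mat_adjoint ?u) = dim_row (1\<^sub>m r)"
    "dim_col (?u * mat_adjoint ?u) = dim_col (1\<^sub>m r)"
    by (auto simp: phased_fourier_mat_def)
  fix a c assume "a < dim_row (1\<^sub>m r :: complex mat)" "c < dim_col (1\<^sub>m r :: complex mat)"
  then have ac: "a < r" "c < r" by auto
  let ?f = "\<lambda>t. fourier d k t" and ?g = "\<lambda>a b. fourier r a b"
  have sq: "complex_of_real (sqrt (real r)) * complex_of_real (sqrt (real r)) = of_nat r"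
    by (simp flip: of_real_mult)
  have "(?u * mat_adjoint ?u) $$ (a, c) = (\<Sum>b<r. ?u $$ (a, b) * cnj (?u $$ (c, b)))"
    by (rule mult_mat_adjoint_index) (use ac in simp_all)
  also have "\<dots> = (\<Sum>b<r. ?f (s + r * a) * cnj (?f (s + r * c)) / of_nat r *
      (?g a b * cnj (?g c b)))"
  proof (intro sum.cong refl)
    fix b assume b: "b \<in> {..<r}"
    have "?u $$ (a, b) * cnj (?u $$ (c, b)) =
        ?f (s + r * a) * cnj (?f (s + r * c)) * (?g a b * cnj (?g c b)) * (?f b * cnj (?f b)) /
        (complex_of_real (sqrt (real r)) * complex_of_real (sqrt (real r)))"
      using ac b by (simp add: phased_fourier_mat_def fourier_add [of d k _ b])
    then show "?u $$ (a, b) * cnj (?u $$ (c, b)) =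
        ?f (s + r * a) * cnj (?f (s + r * c)) / of_nat r * (?g a b * cnj (?g c b))"
      by (simp add: sq)
  qed
  also have "\<dots> = ?f (s + r * a) * cnj (?f (s + r * c)) / of_nat r *
      (\<Sum>b<r. ?g a b * cnj (?g c b))"
    by (rule sum_distrib_left [symmetric])
  also have "\<dots> = (1\<^sub>m r :: complex mat) $$ (a, c)"
    using ac by (simp add: fourier_orthogonal)
  finally show "(?u * mat_adjoint ?u) $$ (a, c) = (1\<^sub>m r :: complex mat) $$ (a, c)" .
qed

text \<open>Here, in contrast, the row is multiplied by the same row for another index \<open>l\<close>, and it is the
  Fourier matrix of order \<open>r\<close> that cancels. The factor \<open>of_nat r\<close> is the weight with which the
  trace counts the block.\<close>

lemma phased_fourier_mat_inner:
  assumes "a < r"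
  shows "of_nat r * (phased_fourier_mat d s r k * mat_adjoint (phased_fourier_mat d s r l)) $$ (a, a)
    = (\<Sum>b<r. fourier d k (s + r * a + b) * cnj (fourier d l (s + r * a + b)))"
proof -
  let ?u = "phased_fourier_mat d s r"
  have sq: "complex_of_real (sqrt (real r)) * complex_of_real (sqrt (real r)) = of_nat r"
    by (simp flip: of_real_mult)
  have "(?u k * mat_adjoint (?u l)) $$ (a, a) = (\<Sum>b<r. ?u k $$ (a, b) * cnj (?u l $$ (a, b)))"
    by (rule mult_mat_adjoint_index) (use assms in simp_all)
  also have "\<dots> = (\<Sum>b<r. fourier d k (s + r * a + b) * cnj (fourier d l (s + r * a + b)) / of_nat r)"
  proof (intro sum.cong refl)
    fix b assume "b \<in> {..<r}"
    then have "?u k $$ (a, b) * cnj (?u l $$ (a, b)) =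
        fourier d k (s + r * a + b) * cnj (fourier d l (s + r * a + b)) *
        (fourier r a b * cnj (fourier r a b)) /
        (complex_of_real (sqrt (real r)) * complex_of_real (sqrt (real r)))"
      using assms by (simp add: phased_fourier_mat_def)
    then show "?u k $$ (a, b) * cnj (?u l $$ (a, b)) =
        fourier d k (s + r * a + b) * cnj (fourier d l (s + r * a + b)) / of_nat r"
      by (simp add: sq)
  qed
  finally show ?thesis using assms by (simp add: sum_distrib_left)
qed

definition basis_unitary :: "nat \<Rightarrow> (nat \<Rightarrow> nat) \<Rightarrow> nat \<Rightarrow> complex mat" where
  "basis_unitary m n k =
     ampliated_sum m n (\<lambda>i. phased_fourier_mat (offset n m) (offset n i) (n i) k)"

lemma basis_unitary_in_block_algebra: "basis_unitary m n k \<in> block_algebra m n"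
  unfolding basis_unitary_def ampliated_sum_def block_algebra_def
  by (rule CollectI, rule exI [of _ "\<lambda>i. phased_fourier_mat (offset n m) (offset n i) (n i) k"]) simp

lemma basis_unitary_carrier [simp]:
  "basis_unitary m n k \<in> carrier_mat (offset n m) (offset n m)"
  unfolding basis_unitary_def by (simp add: ampliated_sum_carrier)

lemma basis_unitary_unitary: "unitary_mat (offset n m) (basis_unitary m n k)"
proof -
  let ?U = "basis_unitary m n k" and ?d = "offset n m"
  have "?U * mat_adjoint ?U = 1\<^sub>m ?d"
    unfolding basis_unitary_def
    by (simp add: ampliated_sum_mult_adjoint phased_fourier_mat_unitary ampliated_sum_one)
  moreover from this have "mat_adjoint ?U * ?U = 1\<^sub>m ?d"
    by (intro mat_mult_left_right_inverse [of ?U ?d]) simp_all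
  ultimately show ?thesis by (simp add: unitary_mat_def)
qed

lemma basis_unitary_orthonormal:
  assumes "k < offset n m" "l < offset n m"
  shows "trace_inner (offset n m) (basis_unitary m n k) (basis_unitary m n l) =
    (if k = l then 1 else 0)"
proof -
  let ?d = "offset n m"
  let ?u = "\<lambda>i. phased_fourier_mat ?d (offset n i) (n i)"
  have prod: "basis_unitary m n k * mat_adjoint (basis_unitary m n l) =
      ampliated_sum m n (\<lambda>i. ?u i k * mat_adjoint (?u i l))"
    unfolding basis_unitary_def by (rule ampliated_sum_mult_adjoint) simp_all
  have "(\<Sum>p<?d. (basis_unitary m n k * mat_adjoint (basis_unitary m n l)) $$ (p, p)) =
      (\<Sum>i<m. of_nat (n i) * (\<Sum>a<n i. (?u i k * mat_adjoint (?u i l)) $$ (a, a)))"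
    unfolding prod
  proof (rule ampliated_sum_diagonal_sum)
    show "?u i k * mat_adjoint (?u i l) \<in> carrier_mat (n i) (n i)" for i
      by (rule mult_carrier_mat [OF _ mat_adjoint_carrier]) (rule phased_fourier_mat_carrier)+
  qed
  also have "\<dots> = (\<Sum>i<m. \<Sum>a<n i. \<Sum>b<n i. fourier ?d k (offset n i + n i * a + b) *
      cnj (fourier ?d l (offset n i + n i * a + b)))"
    by (simp add: sum_distrib_left phased_fourier_mat_inner)
  also have "\<dots> = (\<Sum>t<?d. fourier ?d k t * cnj (fourier ?d l t))"
    by (simp add: sum_lessThan_offset)
  also have "\<dots> = (if k = l then of_nat ?d else 0)"
    by (rule fourier_orthogonal [OF assms])
  finally show ?thesis
    using assms by (auto simp: trace_inner_def normalized_trace_def)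
qed

text \<open>The coefficients are the inverse Fourier transform of the block entries of \<open>A\<close>, each divided by
  the part \<open>?w\<close> of the entry of the basis unitaries that does not depend on \<open>k\<close>.\<close>

lemma basis_unitary_spanning:
  assumes "A \<in> block_algebra m n"
  shows "\<exists>c. \<forall>p<offset n m. \<forall>q<offset n m.
    A $$ (p, q) = (\<Sum>k<offset n m. c k * basis_unitary m n k $$ (p, q))"
proof -
  let ?d = "offset n m"
  let ?w = "\<lambda>i a b. fourier (n i) a b / complex_of_real (sqrt (real (n i)))"
  obtain x where x: "\<And>i. i < m \<Longrightarrow> x i \<in> carrier_mat (n i) (n i)"
    and A: "A = ampliated_sum m n x"
    using assms unfolding block_algebra_def ampliated_sum_def by auto
  obtain y where y: "\<And>i a b. \<lbrakk>i < m; a < n i; b < n i\<rbrakk> \<Longrightarrow>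
      y (offset n i + n i * a + b) = x i $$ (a, b) / ?w i a b"
    using ex_vector_with_block_entries [of m n "\<lambda>i a b. x i $$ (a, b) / ?w i a b"] by blast
  obtain c where c: "\<And>t. t < ?d \<Longrightarrow> (\<Sum>k<?d. c k * fourier ?d k t) = y t"
    using fourier_inversion [of ?d y] by blast
  have "A $$ (p, q) = (\<Sum>k<?d. c k * basis_unitary m n k $$ (p, q))"
    if "p < ?d" "q < ?d" for p q
    using that
  proof (cases rule: ampliated_sum_entry)
    case (inside i a b)
    have w: "?w i a b \<noteq> 0"
      using inside(2) by (simp add: fourier_def)
    have "(\<Sum>k<?d. c k * basis_unitary m n k $$ (p, q)) =
        (\<Sum>k<?d. ?w i a b * (c k * fourier ?d k (offset n i + n i * a + b)))"
      unfolding basis_unitary_def using inside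
      by (simp add: phased_fourier_mat_def mult_ac)
    also have "\<dots> = ?w i a b * (\<Sum>k<?d. c k * fourier ?d k (offset n i + n i * a + b))"
      by (rule sum_distrib_left [symmetric])
    also have "\<dots> = ?w i a b * (x i $$ (a, b) / ?w i a b)"
      using inside(1-3) block_index_less [of i m a n b] by (simp only: c y)
    also have "\<dots> = A $$ (p, q)"
      using w inside(4) [of x] x by (simp add: A)
    finally show ?thesis by simp
  next
    case outside
    then show ?thesis using x by (simp add: A basis_unitary_def)
  qed
  then show ?thesis by blast
qed

theorem theorem2p1:
  fixes m d :: nat and n :: "nat \<Rightarrow> nat"
  assumes "m \<ge> 1"
    and "\<And>i. i < m \<Longrightarrow> n i \<ge> 1"
    and "d = (\<Sum>i<m. (n i)\<^sup>2)"
  shows "\<exists>B. vectorspace.basis class_ring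
               (module_mat TYPE(complex) d d\<lparr>carrier := block_algebra m n\<rparr>) B \<and>
             (\<forall>U\<in>B. unitary_mat d U) \<and>
             (\<forall>U\<in>B. \<forall>V\<in>B. U \<noteq> V \<longrightarrow> trace_inner d U V = 0)"
proof -
  let ?U = "basis_unitary m n"
  have d: "d = offset n m" by (simp add: assms(3) offset_def)
  have inj: "inj_on ?U {..<d}"
  proof (rule inj_onI)
    fix k l assume kl: "k \<in> {..<d}" "l \<in> {..<d}" and eq: "?U k = ?U l"
    have "trace_inner d (?U k) (?U l) = 1"
      using basis_unitary_orthonormal [of k n m k] kl by (simp add: d flip: eq)
    then show "k = l"
      using basis_unitary_orthonormal [of k n m l] kl by (simp add: d split: if_splits)
  qed
  have orth: "trace_inner d U V = (if U = V then 1 else 0)"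
    if "U \<in> ?U ` {..<d}" "V \<in> ?U ` {..<d}" for U V
    using that inj basis_unitary_orthonormal [of _ n m] by (auto simp: d dest: inj_onD)
  have "vectorspace.basis class_ring
      (module_mat TYPE(complex) d d\<lparr>carrier := block_algebra m n\<rparr>) (?U ` {..<d})"
  proof (rule basis_if_trace_orthonormal_spanning [OF block_algebra_vectorspace [OF assms(3)]])
    show "block_algebra m n \<subseteq> carrier_mat d d"
      unfolding assms(3) by (rule block_algebra_carrier)
    show "finite (?U ` {..<d})" by simp
    show "?U ` {..<d} \<subseteq> block_algebra m n"
      using basis_unitary_in_block_algebra by blast
    show "trace_inner d U V = (if U = V then 1 else 0)"
      if "U \<in> ?U ` {..<d}" "V \<in> ?U ` {..<d}" for U V
      using that by (rule orth)
    fix A assume "A \<in> block_algebra m n"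
    then obtain c where c: "\<forall>p<d. \<forall>q<d. A $$ (p, q) = (\<Sum>k<d. c k * ?U k $$ (p, q))"
      using basis_unitary_spanning unfolding d by blast
    have "(\<Sum>k<d. c k * ?U k $$ (p, q)) =
        (\<Sum>U\<in>?U ` {..<d}. c (the_inv_into {..<d} ?U U) * U $$ (p, q))" for p q
      using inj by (simp add: sum.reindex the_inv_into_f_f)
    then show "\<exists>c. \<forall>p<d. \<forall>q<d. A $$ (p, q) = (\<Sum>U\<in>?U ` {..<d}. c U * U $$ (p, q))"
      using c by (intro exI [of _ "\<lambda>U. c (the_inv_into {..<d} ?U U)"]) simp
  qed
  then show ?thesis
    using orth basis_unitary_unitary [of n m] by (intro exI [of _ "?U ` {..<d}"]) (auto simp: d)
qed

end
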